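(* Let $n\geq 5$, let $G=D_{2n}=\langle a,b\mid a^n=b^2=1,\ bab=a^{-1}\rangle$, and let $C=\{b,ba^i,ba^j,ba^k\}$, where $i,j,k,\ell,m$ are integers such that: (i) $1<i,j,k<n$ and $i,j,k$ are pairwise coprime; (ii) $\gcd(x,n)>1$ for each $x\in\{i,j,k\}$; (iii) $\ell^2\equiv m^2\equiv 1\pmod n$, none of $\ell,m,\ell m$ is congruent to $1$ modulo $n$, $k\equiv j\ell+i\equiv im+j\pmod n$, and $i(\ell+1)\equiv j(m+1)\equiv 0\pmod n$. Let $A_0=\mathrm{Aut}(G;C)$. Then: (a) $|C|=4$, $C\in\mathcal{T}(G)$, and if $n$ is even then $n/2\notin\{i,j,k\}$; (b) $A_0=\langle\tau_\ell\varphi^i,\tau_m\varphi^j\rangle\cong\mathbb{Z}_2\times\mathbb{Z}_2$. Moreover, for no $\sigma\in\mathrm{Aut}(G)$ is $C^\sigma$ equal to a set of either of the following two forms: (1) $\{b,ba,ba^{s},ba^{1-s}\}$ with $2\leq s\leq n-1$, $\gcd(2s-1,n)=1$ and $2s(s-1)\equiv 0\pmod n$; (2) $\{b,ba,ba^{t+1},ba^{t^2+t+1}\}$ with $1\leq t\leq n-2$, $\gcd(t,n)=1$ and $1+t+t^2+t^3\equiv 0\pmod n$.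
   Context: Maps are written as exponents and composed from left to right. For $G=\langle a,b\rangle\cong D_{2n}$, define automorphisms $\varphi: a\mapsto a,\ b\mapsto ba$ and, for each integer $k$ with $\gcd(k,n)=1$ (depending only on $k$ modulo $n$), $\tau_k: a\mapsto a^k,\ b\mapsto b$; so $(a^x)^{\tau_k\varphi^y}=a^{xk}$ and $(ba^x)^{\tau_k\varphi^y}=ba^{xk+y}$. For a nontrivial finite group $G$, an inverse-closed generating set is a non-empty subset $C\subseteq G\setminus\{1\}$ with $\langle C\rangle=G$ and $c^{-1}\in C$ for all $c\in C$; $\mathrm{Aut}(G;C)=\{\sigma\in\mathrm{Aut}(G)\mid C^\sigma=C\}$. Such $C$ is called transitive if either $\mathrm{Aut}(G;C)$ is transitive on $C$, or $\mathrm{Aut}(G;C)$ has exactly two orbits $C_+$ and $C_-$ on $C$ and $C_-=\{c^{-1}\mid c\in C_+\}$. $\mathcal{T}(G)$ denotes the set of all transitive inverse-closed generating sets for $G$. *)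

theory Defs
  imports "HOL-Algebra.Algebra" "HOL-Number_Theory.Cong"
begin

section \<open>Dihedral groups\<close>

locale dihedral_relations = group G for G (structure) +
  fixes n :: nat and a b
  assumes a_closed [simp, intro]: "a \<in> carrier G"
    and b_closed [simp, intro]: "b \<in> carrier G"
    and a_pow: "a [^] n = \<one>"
    and b_pow: "b [^] (2::nat) = \<one>"
    and bab: "b \<otimes> a \<otimes> b = inv a"

text \<open>
  The group presented by \<open>a\<^sup>n = b\<^sup>2 = 1\<close>, \<open>bab = a\<^sup>-\<^sup>1\<close>. Since this group has order \<open>2n\<close>,
  a group generated by elements satisfying these relations is presented by them
  precisely when its order is \<open>2n\<close>. The universal property of the presentation is
  \<open>dihedral.presentation\<close> below; \<open>dihedral_model\<close> gives a concrete instance for each \<open>n > 0\<close>.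
\<close>

locale dihedral = dihedral_relations +
  assumes n_pos: "0 < n"
    and generated: "generate G {a, b} = carrier G"
    and order_eq: "order G = 2 * n"


section \<open>Inverse-closed generating sets\<close>

definition inverse_closed_generating_set :: "('a, 'c) monoid_scheme \<Rightarrow> 'a set \<Rightarrow> bool" where
  "inverse_closed_generating_set G C \<longleftrightarrow>
     C \<noteq> {} \<and> C \<subseteq> carrier G - {\<one>\<^bsub>G\<^esub>} \<and> generate G C = carrier G \<and> (\<forall>c\<in>C. inv\<^bsub>G\<^esub> c \<in> C)"

definition Aut_fixing :: "('a, 'c) monoid_scheme \<Rightarrow> 'a set \<Rightarrow> ('a \<Rightarrow> 'a) set" where
  "Aut_fixing G C = {\<sigma> \<in> auto G. \<sigma> ` C = C}"

definition Aut_fixing_group :: "('a, 'c) monoid_scheme \<Rightarrow> 'a set \<Rightarrow> ('a \<Rightarrow> 'a) monoid" where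
  "Aut_fixing_group G C = (AutoGroup G) \<lparr>carrier := Aut_fixing G C\<rparr>"

definition transitive_generating_sets :: "('a, 'c) monoid_scheme \<Rightarrow> 'a set set" where
  "transitive_generating_sets G =
     {C. inverse_closed_generating_set G C \<and>
         (transitive_action (Aut_fixing_group G C) C (\<lambda>\<sigma>. restrict \<sigma> C) \<or>
          (\<exists>Cp Cm. Cp \<noteq> Cm \<and>
             orbits (Aut_fixing_group G C) C (\<lambda>\<sigma>. restrict \<sigma> C) = {Cp, Cm} \<and>
             Cm = {inv\<^bsub>G\<^esub> c | c. c \<in> Cp}))}"


section \<open>Automorphisms of dihedral groups\<close>

text \<open>
  The descriptions are meant for \<open>dihedral G n a b\<close>, with \<open>k\<close> coprime to \<open>n\<close>; see
  \<open>dihedral.phi_ex1\<close> and \<open>dihedral.tau_ex1\<close> for existence and uniqueness.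

  The product of \<open>AutoGroup G\<close> is composition from right to left, so the automorphism written
  \<open>\<tau>\<^sub>k \<phi>\<^sup>y\<close> in exponent notation (first \<open>\<tau>\<^sub>k\<close>, then \<open>\<phi>\<^sup>y\<close>) is
  \<open>dih_phi G a b [^]\<^bsub>AutoGroup G\<^esub> y \<otimes>\<^bsub>AutoGroup G\<^esub> dih_tau G a b k\<close>.
\<close>

definition dih_phi :: "('a, 'c) monoid_scheme \<Rightarrow> 'a \<Rightarrow> 'a \<Rightarrow> 'a \<Rightarrow> 'a" where
  "dih_phi G a b = (THE f. f \<in> auto G \<and> f a = a \<and> f b = b \<otimes>\<^bsub>G\<^esub> a)"

definition dih_tau :: "('a, 'c) monoid_scheme \<Rightarrow> 'a \<Rightarrow> 'a \<Rightarrow> int \<Rightarrow> 'a \<Rightarrow> 'a" where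
  "dih_tau G a b k = (THE f. f \<in> auto G \<and> f a = a [^]\<^bsub>G\<^esub> k \<and> f b = b)"


section \<open>Adequacy of the definitions\<close>

context dihedral_relations
begin

lemma bb: "b \<otimes> b = \<one>"
  using b_pow by (simp add: numeral_2_eq_2)

lemma inv_b: "inv b = b"
  using bb by (simp add: inv_equality)

lemma b_apow_b: "b \<otimes> a [^] x \<otimes> b = a [^] (- x)" for x :: int
proof -
  have hom: "(\<lambda>g. b \<otimes> g \<otimes> b) \<in> hom G G"
  proof (rule homI)
    fix x y assume xy: "x \<in> carrier G" "y \<in> carrier G"
    have "b \<otimes> x \<otimes> b \<otimes> (b \<otimes> y \<otimes> b) = b \<otimes> x \<otimes> ((b \<otimes> b) \<otimes> (y \<otimes> b))"
      using xy by (simp add: m_assoc)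
    then show "b \<otimes> (x \<otimes> y) \<otimes> b = b \<otimes> x \<otimes> b \<otimes> (b \<otimes> y \<otimes> b)"
      using xy by (simp add: m_assoc bb)
  qed simp
  interpret h: group_hom G G "\<lambda>g. b \<otimes> g \<otimes> b"
    using hom by unfold_locales
  show ?thesis
    using h.hom_int_pow[OF a_closed, of x] by (simp add: bab int_pow_neg int_pow_inv)
qed

lemma apow_b: "a [^] x \<otimes> b = b \<otimes> a [^] (- x)" for x :: int
proof -
  have "b \<otimes> a [^] (- x) = b \<otimes> (b \<otimes> a [^] x \<otimes> b)" by (simp add: b_apow_b)
  also have "\<dots> = (b \<otimes> b) \<otimes> (a [^] x \<otimes> b)" by (simp add: m_assoc)
  finally show ?thesis by (simp add: bb)
qed

lemma apow_mod: "a [^] (x mod int n) = a [^] x" for x :: int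
proof -
  have "a [^] x = a [^] (x mod int n + int n * (x div int n))" by simp
  also have "\<dots> = a [^] (x mod int n) \<otimes> (a [^] int n) [^] (x div int n)"
    by (simp only: int_pow_mult[OF a_closed] int_pow_pow[OF a_closed])
  finally show ?thesis using a_pow by (simp add: int_pow_int)
qed

definition nform :: "bool \<Rightarrow> int \<Rightarrow> 'a" where
  "nform e x = (if e then b else \<one>) \<otimes> a [^] x"

lemma nform_closed [simp]: "nform e x \<in> carrier G"
  by (simp add: nform_def)

lemma nform_mod: "nform e (x mod int n) = nform e x"
  by (simp add: nform_def apow_mod)

lemma nform_mult: "nform e x \<otimes> nform f y = nform (e \<noteq> f) ((if f then - x else x) + y)"
proof -
  let ?b = "\<lambda>e. if e then b else \<one>"
  have "nform e x \<otimes> nform f y = ?b e \<otimes> (a [^] x \<otimes> ?b f) \<otimes> a [^] y"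
    by (simp add: nform_def m_assoc)
  also have "a [^] x \<otimes> ?b f = ?b f \<otimes> a [^] (if f then - x else x)"
    by (simp add: apow_b)
  also have "?b e \<otimes> (?b f \<otimes> a [^] (if f then - x else x)) \<otimes> a [^] y
      = (?b e \<otimes> ?b f) \<otimes> (a [^] (if f then - x else x) \<otimes> a [^] y)"
    by (simp add: m_assoc)
  also have "?b e \<otimes> ?b f = ?b (e \<noteq> f)" by (simp add: bb)
  also have "a [^] (if f then - x else x) \<otimes> a [^] y = a [^] ((if f then - x else x) + y)"
    by (simp add: int_pow_mult)
  finally show ?thesis by (simp add: nform_def)
qed

lemma nform_one: "nform False 0 = \<one>"
  and nform_a: "nform False 1 = a"
  and nform_b: "nform True 0 = b"
  by (simp_all add: nform_def)

end

lemma (in group) hom_eq_on_generate: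
  assumes f: "f \<in> hom G H" and g: "g \<in> hom G H" and H: "group H"
    and A: "A \<subseteq> carrier G" "\<And>x. x \<in> A \<Longrightarrow> f x = g x"
    and x: "x \<in> generate G A"
  shows "f x = g x"
proof -
  interpret f: group_hom G H f using f H by (simp add: group_hom_def group_hom_axioms_def)
  interpret g: group_hom G H g using g H by (simp add: group_hom_def group_hom_axioms_def)
  show ?thesis
    using x
  proof (induction rule: generate.induct)
    case (inv h)
    then show ?case using A by (metis f.hom_inv g.hom_inv subsetD)
  next
    case (eng h1 h2)
    then show ?case using generate_in_carrier[OF A(1)] by simp
  qed (use A in auto)
qed

context dihedral
begin

lemma nform_bij: "bij_betw (case_prod nform) (UNIV \<times> {0..<int n}) (carrier G)"
proof -
  let ?S = "case_prod nform ` (UNIV \<times> {0..<int n})"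
  have mem: "nform e x \<in> ?S" for e x
    using n_pos by (intro image_eqI[of _ _ "(e, x mod int n)"]) (auto simp: nform_mod)
  have "g \<in> ?S" if "g \<in> generate G {a, b}" for g
    using that
  proof (induction rule: generate.induct)
    case one
    show ?case using mem[of False 0] by (simp only: nform_one)
  next
    case (incl h)
    then show ?case using mem[of False 1, unfolded nform_a] mem[of True 0, unfolded nform_b] by blast
  next
    case (inv h)
    have "nform False (- 1) = inv a" by (simp add: nform_def int_pow_neg)
    then have "inv a \<in> ?S" using mem[of False "- 1"] by (simp only:)
    moreover have "inv b \<in> ?S" using mem[of True 0] by (simp only: nform_b inv_b)
    ultimately show ?case using inv by blast
  next
    case (eng h1 h2)
    then obtain e x f y where "h1 = nform e x" "h2 = nform f y" by auto
    then show ?case by (simp only: nform_mult mem)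
  qed
  then have S: "?S = carrier G" using generated by auto
  have "card (UNIV \<times> {0..<int n} :: (bool \<times> int) set) = card (carrier G)"
    using order_eq by (simp add: order_def card_cartesian_product)
  then show ?thesis
    using S by (simp add: bij_betw_def eq_card_imp_inj_on)
qed

lemma finite_carrier: "finite (carrier G)"
  using nform_bij bij_betw_finite by fastforce

lemma presentation:
  assumes "dihedral_relations H n x y"
  shows "\<exists>!f. f \<in> hom G H \<inter> extensional (carrier G) \<and> f a = x \<and> f b = y"
proof -
  interpret H: dihedral_relations H n x y by fact
  define D :: "(bool \<times> int) set" where "D = UNIV \<times> {0..<int n}"
  define f where "f = (\<lambda>g\<in>carrier G. case_prod H.nform (inv_into D (case_prod nform) g))"
  have f_nform: "f (nform e z) = H.nform e z" for e z
  proof -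
    have "(e, z mod int n) \<in> D" using n_pos by (simp add: D_def)
    then have "inv_into D (case_prod nform) (nform e (z mod int n)) = (e, z mod int n)"
      using nform_bij inv_into_f_f[of "case_prod nform" D "(e, z mod int n)"]
      by (simp add: bij_betw_def D_def)
    then show ?thesis by (simp add: f_def nform_mod H.nform_mod)
  qed
  have ex: "\<exists>e z. g = nform e z" if "g \<in> carrier G" for g
    using that nform_bij by (force simp: bij_betw_def)
  have "f \<in> hom G H"
  proof (rule homI)
    fix g assume "g \<in> carrier G"
    then show "f g \<in> carrier H" using ex[of g] by (auto simp: f_nform)
  next
    fix g h assume "g \<in> carrier G" "h \<in> carrier G"
    then obtain e z e' z' where "g = nform e z" "h = nform e' z'" using ex by meson
    then show "f (g \<otimes> h) = f g \<otimes>\<^bsub>H\<^esub> f h" by (simp only: f_nform nform_mult H.nform_mult)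
  qed
  moreover have "f \<in> extensional (carrier G)" by (simp add: f_def)
  moreover have "f a = x" "f b = y"
    using f_nform[of False 1] f_nform[of True 0]
    by (simp_all only: nform_a nform_b H.nform_a H.nform_b)
  moreover have "f' = f" if "f' \<in> hom G H \<inter> extensional (carrier G)" "f' a = x" "f' b = y" for f'
  proof (rule extensionalityI)
    show "f' \<in> extensional (carrier G)" "f \<in> extensional (carrier G)"
      using that by (auto simp: f_def)
    fix g assume "g \<in> carrier G"
    then have "g \<in> generate G {a, b}" by (simp add: generated)
    then show "f' g = f g"
    proof (rule hom_eq_on_generate[OF _ \<open>f \<in> hom G H\<close> H.is_group, rotated 3])
      fix z assume "z \<in> {a, b}"
      then show "f' z = f z" using that \<open>f a = x\<close> \<open>f b = y\<close> by (elim insertE emptyE) simp_all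
    qed (use that in auto)
  qed
  ultimately show ?thesis by blast
qed

lemma auto_ex1:
  assumes rel: "dihedral_relations G n x y" and gen: "a \<in> generate G {x, y}" "b \<in> generate G {x, y}"
  shows "\<exists>!f. f \<in> auto G \<and> f a = x \<and> f b = y"
proof -
  from presentation[OF rel] obtain f where
    f: "f \<in> hom G G" "f \<in> extensional (carrier G)" "f a = x" "f b = y" 
    and uniq: "\<And>f'. f' \<in> hom G G \<inter> extensional (carrier G) \<Longrightarrow> f' a = x \<Longrightarrow> f' b = y \<Longrightarrow> f' = f"
    by (elim ex1E) (metis IntD1 IntD2)
  interpret f: group_hom G G f using f by unfold_locales
  have sub: "subgroup (f ` carrier G) G" by (rule f.img_is_subgroup)
  have "{x, y} \<subseteq> f ` carrier G" using f by auto
  then have "generate G {x, y} \<subseteq> f ` carrier G" using sub by (rule generate_subgroup_incl)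
  then have "{a, b} \<subseteq> f ` carrier G" using gen by auto
  then have "generate G {a, b} \<subseteq> f ` carrier G" using sub by (rule generate_subgroup_incl)
  moreover have "f ` carrier G \<subseteq> carrier G" by (intro image_subsetI f.hom_closed)
  ultimately have "f ` carrier G = carrier G" unfolding generated by (rule equalityI[rotated])
  then have "bij_betw f (carrier G) (carrier G)"
    using finite_carrier by (simp add: bij_betw_def eq_card_imp_inj_on)
  then have "f \<in> auto G" using f by (simp add: auto_def Bij_def)
  moreover have "f' = f" if "f' \<in> auto G \<and> f' a = x \<and> f' b = y" for f'
    using that by (intro uniq) (simp_all add: auto_def Bij_def)
  ultimately show ?thesis using f(3,4) by blast
qed

lemma phi_ex1: "\<exists>!f. f \<in> auto G \<and> f a = a \<and> f b = b \<otimes> a"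
proof (rule auto_ex1)
  have ba: "b \<otimes> a = nform True 1" by (simp add: nform_def)
  show "dihedral_relations G n a (b \<otimes> a)"
  proof unfold_locales
    show "(b \<otimes> a) [^] (2::nat) = \<one>"
      by (simp only: numeral_2_eq_2 nat_pow_Suc nat_pow_0 l_one m_closed b_closed a_closed ba
          nform_closed nform_mult if_True) (simp add: nform_one)
    have "b \<otimes> a \<otimes> a \<otimes> (b \<otimes> a) = nform True 1 \<otimes> nform False 1 \<otimes> nform True 1"
      by (simp only: ba nform_a)
    also have "\<dots> = nform False (- 1)" by (simp add: nform_mult)
    also have "\<dots> = inv a" by (simp add: nform_def int_pow_neg)
    finally show "b \<otimes> a \<otimes> a \<otimes> (b \<otimes> a) = inv a" .
  qed (use a_pow in auto)
  show a: "a \<in> generate G {a, b \<otimes> a}" by (simp add: generate.incl)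
  have "b \<otimes> a \<otimes> inv a \<in> generate G {a, b \<otimes> a}"
    by (intro generate.eng generate.incl generate.inv) auto
  then show "b \<in> generate G {a, b \<otimes> a}" by (simp add: m_assoc)
qed

lemma phi_spec:
  "dih_phi G a b \<in> auto G" "dih_phi G a b a = a" "dih_phi G a b b = b \<otimes> a"
  using theI'[OF phi_ex1] unfolding dih_phi_def by blast+

lemma tau_ex1:
  assumes "coprime k (int n)"
  shows "\<exists>!f. f \<in> auto G \<and> f a = a [^] k \<and> f b = b"
proof (rule auto_ex1)
  show "dihedral_relations G n (a [^] k) b"
  proof unfold_locales
    have "(a [^] k) [^] int n = (a [^] int n) [^] k"
      by (simp add: int_pow_pow mult.commute)
    then show "(a [^] k) [^] n = \<one>" using a_pow by (simp add: int_pow_int)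
    show "b \<otimes> a [^] k \<otimes> b = inv (a [^] k)" by (simp add: b_apow_b int_pow_neg)
  qed (use b_pow in auto)
  show "b \<in> generate G {a [^] k, b}" by (simp add: generate.incl)
  obtain u v where "u * k + v * int n = 1"
    using assms by (metis bezout_int coprime_imp_gcd_eq_1)
  then have "a = a [^] (k * u + int n * v)" by (simp add: mult.commute)
  also have "\<dots> = (a [^] k) [^] u \<otimes> (a [^] int n) [^] v"
    by (simp only: int_pow_mult[OF a_closed] int_pow_pow[OF a_closed])
  also have "\<dots> = (a [^] k) [^] u" using a_pow by (simp add: int_pow_int)
  finally have "a = (a [^] k) [^] u" .
  moreover have "subgroup (generate G {a [^] k, b}) G" by (rule generate_is_subgroup) auto
  then have "(a [^] k) [^] u \<in> generate G {a [^] k, b}"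
    using subgroup_int_pow_closed generate.incl[of "a [^] k" "{a [^] k, b}"] by blast
  ultimately show "a \<in> generate G {a [^] k, b}" by simp
qed

lemma tau_spec:
  assumes "coprime k (int n)"
  shows "dih_tau G a b k \<in> auto G" "dih_tau G a b k a = a [^] k" "dih_tau G a b k b = b"
  using theI'[OF tau_ex1[OF assms]] unfolding dih_tau_def by blast+

end

text \<open>In the model, \<open>(e, x)\<close> stands for \<open>b\<^sup>e a\<^sup>x\<close>.\<close>

definition dihedral_model :: "nat \<Rightarrow> (bool \<times> int) monoid" where
  "dihedral_model n =
     \<lparr>carrier = UNIV \<times> {0..<int n},
      monoid.mult = (\<lambda>(e, x) (f, y). (e \<noteq> f, ((if f then - x else x) + y) mod int n)),
      one = (False, 0)\<rparr>"

lemma dihedral_model: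
  assumes n: "0 < n"
  shows "dihedral (dihedral_model n) n (False, 1 mod int n) (True, 0)"
proof -
  let ?D = "dihedral_model n" and ?a = "(False, 1 mod int n)" and ?b = "(True, 0 :: int)"
  have grp: "group ?D"
  proof (rule groupI)
    fix x y z assume "x \<in> carrier ?D" "y \<in> carrier ?D" "z \<in> carrier ?D"
    obtain e u f v g w where "x = (e, u)" "y = (f, v)" "z = (g, w)" by (cases x, cases y, cases z)
    moreover have "((if g then - (p mod int n) else p mod int n) + w) mod int n
        = ((if g then - p else p) + w) mod int n" for p
      by (simp add: mod_diff_right_eq mod_add_left_eq)
    moreover have "(if g then - ((if f then - u else u) + v) else (if f then - u else u) + v) + w
        = (if f \<noteq> g then - u else u) + ((if g then - v else v) + w)"
      by simp
    ultimately show "x \<otimes>\<^bsub>?D\<^esub> y \<otimes>\<^bsub>?D\<^esub> z = x \<otimes>\<^bsub>?D\<^esub> (y \<otimes>\<^bsub>?D\<^esub> z)"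
      unfolding dihedral_model_def
      by (simp only: monoid.simps partial_object.simps prod.case prod.inject
          mod_add_right_eq) blast
  next
    fix x assume x: "x \<in> carrier ?D"
    obtain e u where eu: "x = (e, u)" by force
    show "\<exists>y\<in>carrier ?D. y \<otimes>\<^bsub>?D\<^esub> x = \<one>\<^bsub>?D\<^esub>"
      by (rule bexI[of _ "(e, (if e then u else - u) mod int n)"])
        (use n x eu in \<open>auto simp: dihedral_model_def mod_simps\<close>)
  qed (use n in \<open>auto simp: dihedral_model_def split: prod.splits\<close>)
  interpret group ?D by (rule grp)
  have pow: "?a [^]\<^bsub>?D\<^esub> k = (False, int k mod int n)" for k :: nat
    by (induction k) (use n in \<open>auto simp: dihedral_model_def mod_simps add.commute\<close>)
  have [simp]: "?a \<in> carrier ?D" "?b \<in> carrier ?D" using n by (auto simp: dihedral_model_def)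
  have gen: "generate ?D {?a, ?b} = carrier ?D"
  proof
    show "generate ?D {?a, ?b} \<subseteq> carrier ?D" by (rule generate_incl) auto
    show "carrier ?D \<subseteq> generate ?D {?a, ?b}"
    proof
      fix g assume g: "g \<in> carrier ?D"
      obtain e x where ex: "g = (e, x)" by force
      have x_range: "0 \<le> x" "x < int n" using g ex by (auto simp: dihedral_model_def)
      have "?a [^]\<^bsub>?D\<^esub> k \<in> generate ?D {?a, ?b}" for k :: nat
        by (induction k) (auto intro: generate.one generate.eng generate.incl)
      from this[of "nat x"] have x: "(False, x) \<in> generate ?D {?a, ?b}"
        unfolding pow using x_range by simp
      have "?b \<otimes>\<^bsub>?D\<^esub> (False, x) \<in> generate ?D {?a, ?b}"
        using x by (auto intro: generate.eng generate.incl)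
      moreover have "?b \<otimes>\<^bsub>?D\<^esub> (False, x) = (True, x)"
        using x_range by (simp add: dihedral_model_def)
      ultimately have "(True, x) \<in> generate ?D {?a, ?b}" by (simp only:)
      with x show "g \<in> generate ?D {?a, ?b}" using ex by (cases e) auto
    qed
  qed
  show ?thesis
  proof unfold_locales
    show "?a [^]\<^bsub>?D\<^esub> n = \<one>\<^bsub>?D\<^esub>" by (simp only: pow) (simp add: dihedral_model_def)
    show "?b [^]\<^bsub>?D\<^esub> (2::nat) = \<one>\<^bsub>?D\<^esub>"
      by (simp add: numeral_2_eq_2) (simp add: dihedral_model_def)
    show "?b \<otimes>\<^bsub>?D\<^esub> ?a \<otimes>\<^bsub>?D\<^esub> ?b = inv\<^bsub>?D\<^esub> ?a"
      using n by (intro inv_equality[symmetric]) (auto simp: dihedral_model_def mod_simps)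
    show "order ?D = 2 * n"
      by (simp add: order_def dihedral_model_def card_cartesian_product)
  qed (use n gen in auto)
qed

end

theory Submission
  imports Defs
begin

text \<open>
  The automorphism \<open>\<tau>\<^sub>k \<phi>\<^sup>y\<close> acts on the reflections \<open>b a\<^sup>x\<close> as the affine map \<open>x \<mapsto> k x + y\<close>. The
  congruences say that \<open>\<tau>\<^sub>\<ell> \<phi>\<^sup>i\<close> swaps \<open>0, i\<close> and \<open>j, k\<close>, and that \<open>\<tau>\<^sub>m \<phi>\<^sup>j\<close> swaps \<open>0, j\<close> and
  \<open>i, k\<close>, so \<open>Aut(G;C)\<close> is transitive on \<open>C\<close>. An automorphism fixing \<open>b\<close> and mapping \<open>b a\<^sup>x\<close> to
  \<open>b a\<^sup>y\<close> forces \<open>gcd(x, n) = gcd(y, n)\<close>, because it preserves orders. The numbers \<open>gcd(i, n)\<close>,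
  \<open>gcd(j, n)\<close>, \<open>gcd(k, n)\<close> are pairwise coprime and not \<open>1\<close>, so the stabiliser of \<open>b\<close> fixes the
  generating set \<open>C\<close> pointwise and is trivial. Hence \<open>Aut(G;C)\<close> is regular on \<open>C\<close>. If \<open>\<sigma>\<close> maps
  \<open>C\<close> onto a set containing \<open>b\<close> and \<open>b a\<close>, transitivity allows us to assume that \<open>\<sigma>\<close> fixes \<open>b\<close>,
  and then \<open>gcd(x, n) = gcd(1, n) = 1\<close> for some \<open>x \<in> {i, j, k}\<close>, a contradiction.
\<close>

section \<open>Automorphisms preserving a subset\<close>

context group
begin

lemma AutoGroup_carrier: "carrier (AutoGroup G) = auto G"
  by (simp add: AutoGroup_def)

lemma AutoGroup_mult_apply:
  assumes "f \<in> auto G" "g \<in> auto G" "x \<in> carrier G"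
  shows "(f \<otimes>\<^bsub>AutoGroup G\<^esub> g) x = f (g x)"
  using assms by (simp add: AutoGroup_def BijGroup_def auto_def compose_eq)

lemma AutoGroup_one_apply: "x \<in> carrier G \<Longrightarrow> \<one>\<^bsub>AutoGroup G\<^esub> x = x"
  by (simp add: AutoGroup_def BijGroup_def)

lemma AutoGroup_inv_apply:
  assumes "f \<in> auto G" "x \<in> carrier G"
  shows "(inv\<^bsub>AutoGroup G\<^esub> f) (f x) = x"
proof -
  interpret A: group "AutoGroup G" by (rule AutoGroup)
  have "(inv\<^bsub>AutoGroup G\<^esub> f \<otimes>\<^bsub>AutoGroup G\<^esub> f) x = x"
    using assms by (simp add: AutoGroup_carrier AutoGroup_one_apply)
  moreover have "inv\<^bsub>AutoGroup G\<^esub> f \<in> auto G"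
    using assms A.inv_closed[of f] by (simp add: AutoGroup_carrier)
  ultimately show ?thesis
    using AutoGroup_mult_apply assms by metis
qed

text \<open>Members of \<open>auto G\<close> are extensional, so agreement on a generating set gives
  equality as functions, not merely on the carrier.\<close>

lemma auto_eqI:
  assumes "f \<in> auto G" "g \<in> auto G" "generate G S = carrier G" "S \<subseteq> carrier G"
    and "\<And>x. x \<in> S \<Longrightarrow> f x = g x"
  shows "f = g"
proof (rule extensionalityI)
  show "f \<in> extensional (carrier G)" "g \<in> extensional (carrier G)"
    using assms by (auto simp: auto_def Bij_def)
  fix x assume "x \<in> carrier G"
  then show "f x = g x"
    using assms by (intro hom_eq_on_generate[of f G g S x]) (auto simp: auto_def is_group)
qed

section \<open>The group Aut(G;C) and its action on C\<close>

lemma Aut_fixing_subgroup: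
  assumes "C \<subseteq> carrier G"
  shows "subgroup (Aut_fixing G C) (AutoGroup G)"
proof -
  interpret A: group "AutoGroup G" by (rule AutoGroup)
  have one: "\<one>\<^bsub>AutoGroup G\<^esub> \<in> auto G"
    using A.one_closed by (simp add: AutoGroup_carrier)
  show ?thesis
  proof (rule A.subgroupI)
    show "Aut_fixing G C \<subseteq> carrier (AutoGroup G)"
      by (auto simp: Aut_fixing_def AutoGroup_carrier)
    have "\<one>\<^bsub>AutoGroup G\<^esub> ` C = (\<lambda>x. x) ` C"
      by (rule image_cong) (use assms in \<open>auto simp: AutoGroup_one_apply\<close>)
    then show "Aut_fixing G C \<noteq> {}" using one by (auto simp: Aut_fixing_def)
  next
    fix f assume "f \<in> Aut_fixing G C"
    then have f: "f \<in> auto G" "f ` C = C" by (auto simp: Aut_fixing_def)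
    have "(inv\<^bsub>AutoGroup G\<^esub> f) ` C = (inv\<^bsub>AutoGroup G\<^esub> f) ` (f ` C)" by (simp add: f)
    also have "\<dots> = (\<lambda>x. x) ` C"
      unfolding image_image by (rule image_cong) (use assms f in \<open>auto simp: AutoGroup_inv_apply\<close>)
    finally show "inv\<^bsub>AutoGroup G\<^esub> f \<in> Aut_fixing G C"
      using f A.inv_closed[of f] by (simp add: Aut_fixing_def AutoGroup_carrier)
  next
    fix f g assume "f \<in> Aut_fixing G C" "g \<in> Aut_fixing G C"
    then have fg: "f \<in> auto G" "f ` C = C" "g \<in> auto G" "g ` C = C" by (auto simp: Aut_fixing_def)
    have "(f \<otimes>\<^bsub>AutoGroup G\<^esub> g) ` C = (\<lambda>x. f (g x)) ` C"
      by (rule image_cong) (use assms fg in \<open>auto simp: AutoGroup_mult_apply\<close>)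
    also have "\<dots> = C" using fg by (simp flip: image_image)
    finally show "f \<otimes>\<^bsub>AutoGroup G\<^esub> g \<in> Aut_fixing G C"
      using fg A.m_closed[of f g] by (simp add: Aut_fixing_def AutoGroup_carrier)
  qed
qed

lemma Aut_fixing_group_action:
  assumes "C \<subseteq> carrier G"
  shows "group_action (Aut_fixing_group G C) C (\<lambda>\<sigma>. restrict \<sigma> C)"
proof -
  have grp: "group (Aut_fixing_group G C)"
    unfolding Aut_fixing_group_def
    by (rule subgroup.subgroup_is_group[OF Aut_fixing_subgroup[OF assms] AutoGroup])
  have bij: "restrict f C \<in> Bij C" if "f \<in> Aut_fixing G C" for f
  proof -
    have "inj_on f C" "f ` C = C"
      using that assms by (auto simp: Aut_fixing_def auto_def Bij_def bij_betw_def intro: inj_on_subset)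
    then show ?thesis by (simp add: Bij_def bij_betw_def inj_on_restrict_eq)
  qed
  have "(\<lambda>\<sigma>. restrict \<sigma> C) \<in> hom (Aut_fixing_group G C) (BijGroup C)"
  proof (rule homI)
    fix f assume "f \<in> carrier (Aut_fixing_group G C)"
    then show "restrict f C \<in> carrier (BijGroup C)"
      using bij by (simp add: Aut_fixing_group_def BijGroup_def)
  next
    fix f g assume "f \<in> carrier (Aut_fixing_group G C)" "g \<in> carrier (Aut_fixing_group G C)"
    then have fg: "f \<in> Aut_fixing G C" "g \<in> Aut_fixing G C"
      by (auto simp: Aut_fixing_group_def)
    have "restrict (f \<otimes>\<^bsub>AutoGroup G\<^esub> g) C = compose C (restrict f C) (restrict g C)"
    proof (rule extensionalityI)
      fix x assume "x \<in> C"
      moreover from this have "g x \<in> C" using fg by (auto simp: Aut_fixing_def)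
      ultimately show "restrict (f \<otimes>\<^bsub>AutoGroup G\<^esub> g) C x = compose C (restrict f C) (restrict g C) x"
        using fg assms by (auto simp: Aut_fixing_def AutoGroup_mult_apply compose_eq)
    qed auto
    then show "restrict (f \<otimes>\<^bsub>Aut_fixing_group G C\<^esub> g) C
        = restrict f C \<otimes>\<^bsub>BijGroup C\<^esub> restrict g C"
      using bij fg by (simp add: Aut_fixing_group_def BijGroup_def)
  qed
  then show ?thesis
    using grp group_BijGroup
    by (simp add: group_action_def group_hom_def group_hom_axioms_def)
qed

text \<open>The map (u, v) \<mapsto> x^u y^v is a bijection from the four residue pairs onto the
  four listed elements, and its multiplicativity is a check of sixteen products.\<close>

lemma iso_Z2_times_Z2:
  assumes x: "x \<in> carrier G" "x \<otimes> x = \<one>" "x \<noteq> \<one>"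
    and y: "y \<in> carrier G" "y \<otimes> y = \<one>" "y \<noteq> \<one>"
    and xy: "x \<noteq> y" "x \<otimes> y = y \<otimes> x"
    and carrier: "carrier G = {\<one>, x, y, x \<otimes> y}"
  shows "G \<cong> integer_mod_group 2 \<times>\<times> integer_mod_group 2"
proof -
  let ?Z = "integer_mod_group 2 \<times>\<times> integer_mod_group 2"
  define f where "f = (\<lambda>(u, v). (if u = (0::int) then \<one> else x) \<otimes> (if v = (0::int) then \<one> else y))"
  have Z: "carrier ?Z = {(0, 0), (0, 1), (1, 0), (1, 1)}"
    by (auto simp: carrier_integer_mod_group)
  \<comment> \<open>Cancellation rules that reduce each of the sixteen products to one of the four
    listed elements.\<close>
  have xxy: "x \<otimes> (x \<otimes> z) = z" "y \<otimes> (y \<otimes> z) = z" if "z \<in> carrier G" for z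
    using that x(1,2) y(1,2) by (simp_all flip: m_assoc)
  have yxy: "y \<otimes> (x \<otimes> y) = x"
    using xxy(2)[OF x(1)] by (simp add: xy(2))
  have ne: "x \<otimes> y \<noteq> \<one>" "x \<otimes> y \<noteq> x" "x \<otimes> y \<noteq> y"
    using xxy(1)[OF y(1)] x y xy(1) r_cancel_one by auto
  have hom: "f \<in> hom ?Z G"
  proof (rule homI)
    fix p q assume "p \<in> carrier ?Z" "q \<in> carrier ?Z"
    then show "f (p \<otimes>\<^bsub>?Z\<^esub> q) = f p \<otimes> f q"
      unfolding Z using x(1,2) y(1,2)
      by (elim insertE emptyE) (simp_all add: f_def m_assoc xxy yxy flip: xy(2))
  qed (use x y in \<open>auto simp: Z f_def\<close>)
  have "bij_betw f (carrier ?Z) (carrier G)"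
    unfolding bij_betw_def Z carrier
    using x y xy(1) ne ne[symmetric] by (auto simp: f_def inj_on_def)
  with hom have "f \<in> iso ?Z G" by (simp add: iso_def)
  then have "?Z \<cong> G" by (rule is_isoI)
  moreover have "group ?Z" by (simp add: DirProd_group)
  ultimately show ?thesis by (rule group.iso_sym[rotated])
qed

end

section \<open>Automorphisms of dihedral groups\<close>

context dihedral
begin

text \<open>Exponents here are arbitrary integers; reducing them modulo n lands in the range on
  which \<open>nform_bij\<close> gives uniqueness of the normal form.\<close>

lemma nform_eq_iff: "nform e x = nform f y \<longleftrightarrow> e = f \<and> [x = y] (mod int n)"
proof
  assume eq: "nform e x = nform f y"
  have "inj_on (case_prod nform) (UNIV \<times> {0..<int n})"
    using nform_bij by (simp add: bij_betw_def)
  moreover have "case_prod nform (e, x mod int n) = case_prod nform (f, y mod int n)"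
    using eq by (simp add: nform_mod)
  ultimately have "(e, x mod int n) = (f, y mod int n)"
    by (rule inj_onD) (use n_pos in auto)
  then show "e = f \<and> [x = y] (mod int n)" by (simp add: cong_def)
next
  assume "e = f \<and> [x = y] (mod int n)"
  then have "nform e (x mod int n) = nform f (y mod int n)" by (simp add: cong_def)
  then show "nform e x = nform f y" by (simp only: nform_mod)
qed

lemma b_apow: "b \<otimes> a [^] x = nform True x" for x :: int
  by (simp add: nform_def)

lemma nform_False: "nform False x = a [^] x"
  by (simp add: nform_def)

text \<open>Rotations are scaled by k, while b a^x goes to b a^y a^(k x); this is the affine action
  on exponents used throughout.\<close>

lemma hom_nform:
  assumes "f \<in> hom G G" "f a = a [^] k" "f b = nform True y"
  shows "f (nform e x) = nform e (k * x + (if e then y else 0))"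
proof -
  interpret f: group_hom G G f using assms(1) by unfold_locales
  have "f (nform False x) = nform False (k * x)" for x
    using f.hom_int_pow[OF a_closed, of x] assms(2) by (simp add: nform_False int_pow_pow)
  moreover have "nform e x = (if e then b else \<one>) \<otimes> nform False x"
    by (simp add: nform_def)
  ultimately show ?thesis
    using assms(3) nform_mult[of True y False "k * x"] by (simp add: add.commute)
qed

lemma phi_pow_nform:
  "(dih_phi G a b [^]\<^bsub>AutoGroup G\<^esub> y) (nform e x) = nform e (x + (if e then y else 0))" for y :: int
proof -
  interpret A: group "AutoGroup G" by (rule AutoGroup)
  let ?phi = "dih_phi G a b"
  have phi: "?phi \<in> carrier (AutoGroup G)"
    using phi_spec(1) by (simp add: AutoGroup_carrier)
  have pow: "?phi [^]\<^bsub>AutoGroup G\<^esub> z \<in> auto G" for z :: int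
    using A.int_pow_closed[OF phi, of z] by (simp add: AutoGroup_carrier)
  have phi_nform: "?phi (nform e x) = nform e (x + (if e then 1 else 0))" for e x
    using hom_nform[of ?phi 1 1] phi_spec by (simp add: auto_def nform_def)
  have step: "(?phi [^]\<^bsub>AutoGroup G\<^esub> (z + 1)) (nform e x)
      = (?phi [^]\<^bsub>AutoGroup G\<^esub> z) (nform e (x + (if e then 1 else 0)))" for z :: int and x
    using phi pow phi_spec(1) phi_nform[of e x] A.int_pow_mult[OF phi, of z 1]
    by (simp add: AutoGroup_mult_apply)
  show ?thesis
  proof (induction y arbitrary: x rule: int_induct[where k = 0])
    case base
    then show ?case by (simp add: AutoGroup_one_apply)
  next
    case (step1 y)
    show ?case unfolding step step1.IH by (simp add: add_ac)
  next
    case (step2 y)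
    \<comment> \<open>Downward step: phi^y is phi^(y-1) after phi, so evaluating it one shift
      earlier gives the value of phi^(y-1) at x.\<close>
    then show ?case
      using step[of "y - 1" "x - (if e then 1 else 0)"] by (simp add: algebra_simps split: if_splits)
  qed
qed

lemma phi_pow_tau_auto:
  assumes "coprime k (int n)"
  shows "dih_phi G a b [^]\<^bsub>AutoGroup G\<^esub> (y::int) \<otimes>\<^bsub>AutoGroup G\<^esub> dih_tau G a b k \<in> auto G"
proof -
  interpret A: group "AutoGroup G" by (rule AutoGroup)
  show ?thesis
    using phi_spec(1) tau_spec(1)[OF assms]
    by (metis A.int_pow_closed A.m_closed AutoGroup_carrier)
qed

text \<open>Products compose from right to left, so tau scales the exponent first and the power of
  phi then translates it on reflections.\<close>

lemma phi_pow_tau_nform: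
  fixes y :: int
  assumes "coprime k (int n)"
  shows "(dih_phi G a b [^]\<^bsub>AutoGroup G\<^esub> y \<otimes>\<^bsub>AutoGroup G\<^esub> dih_tau G a b k) (nform e x)
    = nform e (k * x + (if e then y else 0))"
proof -
  interpret A: group "AutoGroup G" by (rule AutoGroup)
  have "dih_phi G a b [^]\<^bsub>AutoGroup G\<^esub> y \<in> auto G"
    using phi_spec(1) by (metis A.int_pow_closed AutoGroup_carrier)
  moreover have "dih_tau G a b k (nform e x) = nform e (k * x)"
    using hom_nform[of "dih_tau G a b k" k 0] tau_spec[OF assms] by (simp add: auto_def nform_b)
  ultimately show ?thesis
    using tau_spec(1)[OF assms] by (simp add: AutoGroup_mult_apply phi_pow_nform)
qed

text \<open>Since a^x is the product of b and b a^x, the rotation a^x is sent to a^y. Injectivity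
  then gives x and y the same annihilators modulo n, and these determine the gcd with n. The case x
  = 0 is included, with gcd n.\<close>

lemma auto_fixing_b_gcd:
  assumes f: "f \<in> auto G" "f b = b" "f (nform True x) = nform True y"
  shows "gcd x (int n) = gcd y (int n)"
proof -
  interpret f: group_hom G G f
    using f(1) by unfold_locales (simp add: auto_def)
  have "nform False z = b \<otimes> nform True z" for z
    using nform_mult[of True 0 True z] by (simp add: nform_b)
  then have fxy: "f (nform False x) = nform False y"
    using f by simp
  have "f (nform False (x * z)) = nform False (y * z)" for z
    using f.hom_int_pow[of "nform False x" z] fxy by (simp add: nform_False int_pow_pow)
  moreover have "f g = \<one> \<longleftrightarrow> g = \<one>" if "g \<in> carrier G" for g
    using f(1) that f.hom_one by (metis (no_types, lifting) Bij_def Int_iff auto_def bij_betw_def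
        inj_onD mem_Collect_eq one_closed)
  ultimately have "nform False (y * z) = nform False 0 \<longleftrightarrow> nform False (x * z) = nform False 0" for z
    by (metis nform_closed nform_one)
  then have dvd: "int n dvd y * z \<longleftrightarrow> int n dvd x * z" for z
    by (simp add: nform_eq_iff cong_0_iff)
  \<comment> \<open>Test with z = n / d for d = gcd(u, n): n divides u z, hence v z, and cancelling
    z leaves d dividing v.\<close>
  have "gcd u (int n) dvd v" if "\<And>z. int n dvd u * z \<Longrightarrow> int n dvd v * z" for u v
  proof -
    define d where "d = gcd u (int n)"
    obtain u' n' where "u = d * u'" "int n = d * n'"
      unfolding d_def by (meson dvdE gcd_dvd1 gcd_dvd2)
    moreover from this have "int n dvd u * n'" by simp
    ultimately have "d dvd v"
      using that[of n'] n_pos by (cases "n' = 0") (simp_all add: mult.commute)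
    then show ?thesis by (simp only: d_def)
  qed
  then have "gcd x (int n) dvd y" "gcd y (int n) dvd x" using dvd by blast+
  then show ?thesis by (intro zdvd_antisym_nonneg) simp_all
qed

text \<open>Multiplying by b turns the two reflections into a^x and a^y, and a Bezout combination of
  x and y recovers a.\<close>

lemma generate_reflections:
  assumes "C \<subseteq> carrier G" "b \<in> C" "nform True x \<in> C" "nform True y \<in> C" "coprime x y"
  shows "generate G C = carrier G"
proof -
  interpret S: subgroup "generate G C" G by (rule generate_is_subgroup) fact
  have b: "b \<in> generate G C" using assms by (simp add: generate.incl)
  have pow: "nform False z \<in> generate G C" if "nform True z \<in> C" for z
    using S.m_closed[OF b generate.incl[OF that]] nform_mult[of True 0 True z] by (simp add: nform_b)
  obtain u v where "x * u + y * v = 1"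
    using assms(5) by (metis bezout_int coprime_imp_gcd_eq_1 mult.commute)
  then have "a = a [^] (x * u + y * v)" by simp
  also have "\<dots> = nform False x [^] u \<otimes> nform False y [^] v"
    by (simp add: int_pow_mult int_pow_pow nform_False)
  finally have "a \<in> generate G C"
    using pow assms by (metis S.m_closed S.subgroup_axioms subgroup_int_pow_closed)
  with b have "generate G {a, b} \<subseteq> generate G C"
    by (intro generate_subgroup_incl S.subgroup_axioms) auto
  then show ?thesis using generated generate_incl[OF assms(1)] by auto
qed

end

section \<open>The four-element connection sets\<close>

locale dihedral_klein = dihedral +
  fixes i j k l m :: int
  assumes range: "1 < i" "i < int n" "1 < j" "j < int n" "1 < k" "k < int n"
    and coprime_ijk: "coprime i j" "coprime i k" "coprime j k"
    and gcd_n: "\<And>x. x \<in> {i, j, k} \<Longrightarrow> gcd x (int n) > 1"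
    and lm: "[l\<^sup>2 = 1] (mod int n)" "[m\<^sup>2 = 1] (mod int n)"
    and k_cong: "[k = j * l + i] (mod int n)" "[k = i * m + j] (mod int n)"
    and ij_cong: "[i * (l + 1) = 0] (mod int n)" "[j * (m + 1) = 0] (mod int n)"
begin

definition "C = nform True ` {0, i, j, k}"

text \<open>In exponent notation \<open>\<alpha>\<close> is tau_l phi^i and \<open>\<beta>\<close>
  below is tau_m phi^j; on reflections they act as x \<mapsto> l x + i and x \<mapsto> m x +
  j.\<close>

definition "\<alpha> = dih_phi G a b [^]\<^bsub>AutoGroup G\<^esub> i \<otimes>\<^bsub>AutoGroup G\<^esub> dih_tau G a b l"

definition "\<beta> = dih_phi G a b [^]\<^bsub>AutoGroup G\<^esub> j \<otimes>\<^bsub>AutoGroup G\<^esub> dih_tau G a b m"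

text \<open>Both l and m are their own inverses modulo n.\<close>

lemma coprime_lm: "coprime l (int n)" "coprime m (int n)"
  using lm by (metis coprime_iff_invertible_int power2_eq_square)+

lemma nform_inj: "inj_on (nform True) {0, i, j, k}"
proof (rule inj_onI)
  fix x y assume "x \<in> {0, i, j, k}" "y \<in> {0, i, j, k}" "nform True x = nform True y"
  then have "x mod int n = y mod int n" "0 \<le> x" "x < int n" "0 \<le> y" "y < int n"
    using range by (auto simp: nform_eq_iff cong_def)
  then show "x = y" by simp
qed

lemma distinct_ijk: "i \<noteq> j" "i \<noteq> k" "j \<noteq> k"
  using coprime_ijk range by auto

lemma C_carrier: "C \<subseteq> carrier G"
  by (auto simp: C_def)

lemma C_eq: "C = {b, b \<otimes> a [^] i, b \<otimes> a [^] j, b \<otimes> a [^] k}"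
  unfolding b_apow by (simp add: C_def nform_b)

lemma b_in_C: "b \<in> C"
  by (simp add: C_eq)

lemma card_C: "card C = 4"
  unfolding C_def card_image[OF nform_inj] using range distinct_ijk by simp

text \<open>If n/2 were one of the three, the other two would be coprime to n/2 but not to n = 2
  (n/2). Both would then be even, contradicting their coprimality.\<close>

lemma half_n_notin:
  assumes "even n"
  shows "int n div 2 \<notin> {i, j, k}"
proof
  have two: "even x" if "x \<in> {i, j, k}" "coprime x (int n div 2)" for x
  proof -
    have n2: "int n = int n div 2 * 2" using assms by simp
    have "\<not> coprime x (int n)" using gcd_n[OF that(1)] by auto
    then have "\<not> coprime x 2" using that(2) n2 by (metis coprime_mult_right_iff)
    then show ?thesis by simp
  qed
  have odd: "\<not> (even x \<and> even y)" if "coprime x y" for x y :: int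
    using coprime_common_divisor[OF that, of 2] by auto
  assume "int n div 2 \<in> {i, j, k}"
  then consider "int n div 2 = i" | "int n div 2 = j" | "int n div 2 = k" by blast
  then show False
  proof cases
    case 1
    then show ?thesis
      using two[of j] two[of k] odd[OF coprime_ijk(3)] coprime_ijk by (simp add: coprime_commute)
  next
    case 2
    then show ?thesis
      using two[of i] two[of k] odd[OF coprime_ijk(2)] coprime_ijk by (simp add: coprime_commute)
  next
    case 3
    then show ?thesis
      using two[of i] two[of j] odd[OF coprime_ijk(1)] coprime_ijk by (simp add: coprime_commute)
  qed
qed

lemma C_generates: "generate G C = carrier G"
  by (rule generate_reflections[OF C_carrier, of i j])
    (use coprime_ijk in \<open>auto simp: C_def nform_b\<close>)

lemma C_inverse_closed: "inverse_closed_generating_set G C"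
proof -
  have "nform True x \<noteq> \<one>" for x
    unfolding nform_one[symmetric] by (simp add: nform_eq_iff)
  moreover have "inv (nform True x) = nform True x" for x
    by (rule inv_equality) (simp_all add: nform_mult nform_one)
  ultimately show ?thesis
    using C_carrier C_generates by (auto simp: inverse_closed_generating_set_def C_def)
qed

section \<open>Two involutions in Aut(G;C)\<close>

lemma alpha_auto: "\<alpha> \<in> auto G" and beta_auto: "\<beta> \<in> auto G"
  unfolding \<alpha>_def \<beta>_def using coprime_lm by (simp_all add: phi_pow_tau_auto)

text \<open>The congruence for i (l + 1) sends i back to 0, the one expressing k through j and l
  sends j to k, and together with l^2 = 1 they send k back to j.\<close>

lemma alpha_apply:
  "\<alpha> b = nform True i" "\<alpha> (nform True i) = b"
  "\<alpha> (nform True j) = nform True k" "\<alpha> (nform True k) = nform True j"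
proof -
  have eval: "\<alpha> (nform True x) = nform True (l * x + i)" for x
    unfolding \<alpha>_def using coprime_lm by (simp add: phi_pow_tau_nform)
  show "\<alpha> b = nform True i" using eval[of 0] by (simp add: nform_b)
  show "\<alpha> (nform True i) = b"
    using ij_cong(1) nform_eq_iff[of True "l * i + i" True 0]
    by (simp add: eval nform_b algebra_simps)
  show "\<alpha> (nform True j) = nform True k"
    using k_cong(1) by (simp add: eval nform_eq_iff mult.commute cong_sym)
  have "[l * k + i = l * (j * l + i) + i] (mod int n)"
    by (intro cong_add cong_mult cong_refl k_cong)
  also have "l * (j * l + i) + i = j * l\<^sup>2 + i * (l + 1)"
    by (simp add: algebra_simps power2_eq_square)
  also have "[j * l\<^sup>2 + i * (l + 1) = j * 1 + 0] (mod int n)"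
    by (intro cong_add cong_mult cong_refl lm ij_cong)
  finally show "\<alpha> (nform True k) = nform True j" by (simp add: eval nform_eq_iff)
qed

lemma beta_apply:
  "\<beta> b = nform True j" "\<beta> (nform True j) = b"
  "\<beta> (nform True i) = nform True k" "\<beta> (nform True k) = nform True i"
proof -
  have eval: "\<beta> (nform True x) = nform True (m * x + j)" for x
    unfolding \<beta>_def using coprime_lm by (simp add: phi_pow_tau_nform)
  show "\<beta> b = nform True j" using eval[of 0] by (simp add: nform_b)
  show "\<beta> (nform True j) = b"
    using ij_cong(2) nform_eq_iff[of True "m * j + j" True 0]
    by (simp add: eval nform_b algebra_simps)
  show "\<beta> (nform True i) = nform True k"
    using k_cong(2) by (simp add: eval nform_eq_iff mult.commute cong_sym)
  have "[m * k + j = m * (i * m + j) + j] (mod int n)"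
    by (intro cong_add cong_mult cong_refl k_cong)
  also have "m * (i * m + j) + j = i * m\<^sup>2 + j * (m + 1)"
    by (simp add: algebra_simps power2_eq_square)
  also have "[i * m\<^sup>2 + j * (m + 1) = i * 1 + 0] (mod int n)"
    by (intro cong_add cong_mult cong_refl lm ij_cong)
  finally show "\<beta> (nform True k) = nform True i" by (simp add: eval nform_eq_iff)
qed

lemma alpha_Aut_fixing: "\<alpha> \<in> Aut_fixing G C" and beta_Aut_fixing: "\<beta> \<in> Aut_fixing G C"
  using alpha_auto beta_auto by (auto simp: Aut_fixing_def C_def nform_b alpha_apply beta_apply)

section \<open>Triviality of the stabiliser of b and regularity on C\<close>

sublocale A: group "AutoGroup G"
  by (rule AutoGroup)

sublocale A0: subgroup "Aut_fixing G C" "AutoGroup G"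
  by (rule Aut_fixing_subgroup[OF C_carrier])

text \<open>Such an f permutes the indices 0, i, j, k and preserves their gcd with n. These four
  gcds are pairwise distinct, so f fixes the generating set C pointwise.\<close>

lemma stabilizer_b_trivial:
  assumes f: "f \<in> Aut_fixing G C" "f b = b"
  shows "f = \<one>\<^bsub>AutoGroup G\<^esub>"
proof (rule auto_eqI[OF _ _ C_generates C_carrier])
  show auto: "f \<in> auto G" using f by (simp add: Aut_fixing_def)
  show "\<one>\<^bsub>AutoGroup G\<^esub> \<in> auto G" using A.one_closed by (simp add: AutoGroup_carrier)
  fix c assume "c \<in> C"
  then obtain x where x: "x \<in> {0, i, j, k}" "c = nform True x" by (auto simp: C_def)
  have "f c \<in> C" using f \<open>c \<in> C\<close> by (auto simp: Aut_fixing_def)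
  then obtain y where y: "y \<in> {0, i, j, k}" "f c = nform True y" by (auto simp: C_def)
  have gcd: "gcd x (int n) = gcd y (int n)"
    using auto_fixing_b_gcd[OF auto f(2)] x y by simp
  \<comment> \<open>The index 0 has gcd n, whereas the others have a smaller gcd; hence 0 can be
    matched only with 0.\<close>
  have lt: "gcd z (int n) < int n" if "z \<in> {i, j, k}" for z
  proof -
    have "gcd z (int n) \<le> z" using that range by (intro gcd_le1_int) auto
    also have "z < int n" using that range by auto
    finally show ?thesis .
  qed
  have "x = y"
  proof (cases "x = 0 \<or> y = 0")
    case True
    then show ?thesis
      using gcd lt[of x] lt[of y] x(1) y(1) by auto
  next
    case False
    then have xy: "x \<in> {i, j, k}" "y \<in> {i, j, k}" using x(1) y(1) by auto
    \<comment> \<open>The common gcd with n divides both x and y and exceeds 1. Pairwise coprimality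
      of i, j, k then leaves only x = y.\<close>
    have "\<not> coprime x y"
    proof
      assume "coprime x y"
      moreover have "gcd x (int n) dvd y" using gcd by simp
      ultimately have "is_unit (gcd x (int n))"
        by (intro coprime_common_divisor[of x y]) simp_all
      then have "\<bar>gcd x (int n)\<bar> = 1" by (simp only: zdvd1_eq)
      then show False using gcd_n[OF xy(1)] by linarith
    qed
    then show ?thesis
      using xy coprime_ijk by (elim insertE emptyE) (simp_all add: coprime_commute)
  qed
  then show "f c = \<one>\<^bsub>AutoGroup G\<^esub> c"
    using x y by (simp add: AutoGroup_one_apply)
qed

text \<open>The quotient of f and g fixes b, so it is trivial: an element of Aut(G;C) is determined
  by its value at b.\<close>

lemma Aut_fixing_eqI:
  assumes "f \<in> Aut_fixing G C" "g \<in> Aut_fixing G C" "f b = g b"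
  shows "f = g"
proof -
  have auto: "f \<in> auto G" "g \<in> auto G" using assms by (auto simp: Aut_fixing_def)
  have inv: "inv\<^bsub>AutoGroup G\<^esub> f \<in> Aut_fixing G C" using assms by simp
  then have "(inv\<^bsub>AutoGroup G\<^esub> f \<otimes>\<^bsub>AutoGroup G\<^esub> g) b = (inv\<^bsub>AutoGroup G\<^esub> f) (g b)"
    using auto by (intro AutoGroup_mult_apply) (auto simp: Aut_fixing_def)
  also have "\<dots> = b"
    using AutoGroup_inv_apply[OF auto(1) b_closed] assms(3) by simp
  finally have "inv\<^bsub>AutoGroup G\<^esub> f \<otimes>\<^bsub>AutoGroup G\<^esub> g = \<one>\<^bsub>AutoGroup G\<^esub>"
    using assms inv by (intro stabilizer_b_trivial A0.m_closed)
  then have "inv\<^bsub>AutoGroup G\<^esub> g = inv\<^bsub>AutoGroup G\<^esub> f"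
    using auto inv by (intro A.inv_equality) (auto simp: AutoGroup_carrier Aut_fixing_def)
  then show ?thesis
    using auto A.inv_inv by (metis AutoGroup_carrier)
qed

lemma mult_apply:
  assumes "f \<in> Aut_fixing G C" "g \<in> Aut_fixing G C" "x \<in> carrier G"
  shows "(f \<otimes>\<^bsub>AutoGroup G\<^esub> g) x = f (g x)"
  using assms by (intro AutoGroup_mult_apply) (auto simp: Aut_fixing_def)

lemma orbit_b: "(\<lambda>f. f b) ` {\<one>\<^bsub>AutoGroup G\<^esub>, \<alpha>, \<beta>, \<alpha> \<otimes>\<^bsub>AutoGroup G\<^esub> \<beta>} = C"
  using alpha_Aut_fixing beta_Aut_fixing
  by (auto simp: C_def AutoGroup_one_apply mult_apply alpha_apply beta_apply nform_b)

text \<open>The four listed elements already send b to every point of C, and no two elements of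
  Aut(G;C) agree at b.\<close>

lemma Aut_fixing_eq:
  "Aut_fixing G C = {\<one>\<^bsub>AutoGroup G\<^esub>, \<alpha>, \<beta>, \<alpha> \<otimes>\<^bsub>AutoGroup G\<^esub> \<beta>}" (is "_ = ?K")
proof
  show K: "?K \<subseteq> Aut_fixing G C"
    using alpha_Aut_fixing beta_Aut_fixing by simp
  show "Aut_fixing G C \<subseteq> ?K"
  proof
    fix f assume f: "f \<in> Aut_fixing G C"
    then have "f b \<in> C" using b_in_C by (auto simp: Aut_fixing_def)
    then have "f b \<in> (\<lambda>f. f b) ` ?K" by (simp only: orbit_b)
    then obtain g where "f b = g b" and g: "g \<in> ?K" by (rule imageE)
    then have "f = g" using f subsetD[OF K g] by (intro Aut_fixing_eqI)
    then show "f \<in> ?K" using g by (simp only:)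
  qed
qed

section \<open>Transitivity and the structure of Aut(G;C)\<close>

lemma Aut_fixing_transitive:
  assumes "c \<in> C"
  obtains f where "f \<in> Aut_fixing G C" "f b = c"
proof -
  have "c \<in> (\<lambda>f. f b) ` Aut_fixing G C" using assms by (simp only: orbit_b Aut_fixing_eq)
  then show ?thesis using that by blast
qed

lemma C_transitive: "C \<in> transitive_generating_sets G"
proof -
  interpret act: group_action "Aut_fixing_group G C" C "\<lambda>\<sigma>. restrict \<sigma> C"
    by (rule Aut_fixing_group_action[OF C_carrier])
  have "transitive_action (Aut_fixing_group G C) C (\<lambda>\<sigma>. restrict \<sigma> C)"
  proof unfold_locales
    fix x y assume xy: "x \<in> C" "y \<in> C"
    obtain f where f: "f \<in> Aut_fixing G C" "f b = x" using Aut_fixing_transitive[OF xy(1)] .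
    obtain g where g: "g \<in> Aut_fixing G C" "g b = y" using Aut_fixing_transitive[OF xy(2)] .
    \<comment> \<open>Transport through the base point: x goes to b under the inverse of f, then to
      y under g.\<close>
    let ?h = "g \<otimes>\<^bsub>AutoGroup G\<^esub> inv\<^bsub>AutoGroup G\<^esub> f"
    have inv: "inv\<^bsub>AutoGroup G\<^esub> f \<in> Aut_fixing G C" using f by simp
    have "?h x = g ((inv\<^bsub>AutoGroup G\<^esub> f) (f b))"
      using f g inv C_carrier xy
      by (subst AutoGroup_mult_apply) (auto simp: Aut_fixing_def)
    also have "\<dots> = y"
      using AutoGroup_inv_apply[of f b] f(1) g by (simp add: Aut_fixing_def)
    finally have "?h x = y" .
    then show "\<exists>h\<in>carrier (Aut_fixing_group G C). restrict h C x = y"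
      using xy g inv by (intro bexI[of _ ?h]) (simp_all add: Aut_fixing_group_def)
  qed
  then show ?thesis
    using C_inverse_closed by (simp add: transitive_generating_sets_def)
qed

lemma Aut_fixing_generate: "Aut_fixing G C = generate (AutoGroup G) {\<alpha>, \<beta>}"
proof
  show "generate (AutoGroup G) {\<alpha>, \<beta>} \<subseteq> Aut_fixing G C"
    using alpha_Aut_fixing beta_Aut_fixing
    by (intro A.generate_subgroup_incl A0.subgroup_axioms) auto
  show "Aut_fixing G C \<subseteq> generate (AutoGroup G) {\<alpha>, \<beta>}"
    unfolding Aut_fixing_eq by (auto intro: generate.intros)
qed

text \<open>Every relation is checked at b alone: the squares of \<open>\<alpha>\<close> and
  \<open>\<beta>\<close> fix b, and both products of \<open>\<alpha>\<close> and
  \<open>\<beta>\<close> send b to b a^k.\<close>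

lemma Aut_fixing_iso: "Aut_fixing_group G C \<cong> integer_mod_group 2 \<times>\<times> integer_mod_group 2"
proof -
  note mem = alpha_Aut_fixing beta_Aut_fixing
  note eqI = Aut_fixing_eqI
  note eval = mult_apply AutoGroup_one_apply alpha_apply beta_apply
  interpret K: group "Aut_fixing_group G C"
    unfolding Aut_fixing_group_def by (rule A.subgroup_imp_group[OF A0.subgroup_axioms])
  have ne: "nform True i \<noteq> b" "nform True j \<noteq> b" "nform True i \<noteq> nform True j"
    using inj_onD[OF nform_inj, of i 0] inj_onD[OF nform_inj, of j 0] inj_onD[OF nform_inj, of i j]
      range distinct_ijk by (auto simp: nform_b)
  have ops: "carrier (Aut_fixing_group G C) = Aut_fixing G C"
    "\<one>\<^bsub>Aut_fixing_group G C\<^esub> = \<one>\<^bsub>AutoGroup G\<^esub>"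
    "\<And>f g. f \<otimes>\<^bsub>Aut_fixing_group G C\<^esub> g = f \<otimes>\<^bsub>AutoGroup G\<^esub> g"
    by (simp_all add: Aut_fixing_group_def)
  show ?thesis
  proof (rule K.iso_Z2_times_Z2[of \<alpha> \<beta>], unfold ops)
    show "\<alpha> \<otimes>\<^bsub>AutoGroup G\<^esub> \<alpha> = \<one>\<^bsub>AutoGroup G\<^esub>"
      by (rule eqI) (use mem in \<open>simp_all add: eval\<close>)
    show "\<beta> \<otimes>\<^bsub>AutoGroup G\<^esub> \<beta> = \<one>\<^bsub>AutoGroup G\<^esub>"
      by (rule eqI) (use mem in \<open>simp_all add: eval\<close>)
    show "\<alpha> \<otimes>\<^bsub>AutoGroup G\<^esub> \<beta> = \<beta> \<otimes>\<^bsub>AutoGroup G\<^esub> \<alpha>"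
      by (rule eqI) (use mem in \<open>simp_all add: eval\<close>)
    show "\<alpha> \<noteq> \<one>\<^bsub>AutoGroup G\<^esub>" "\<beta> \<noteq> \<one>\<^bsub>AutoGroup G\<^esub>" "\<alpha> \<noteq> \<beta>"
      using ne alpha_apply(1) beta_apply(1) AutoGroup_one_apply[OF b_closed] by auto
  qed (fact mem Aut_fixing_eq)+
qed

text \<open>Both excluded forms contain b and b a, so one contradiction serves for both.
  Precomposing with an element of Aut(G;C) gives an automorphism that fixes b and has the same image
  of C.\<close>

lemma b_ba_notin_image:
  assumes \<sigma>: "\<sigma> \<in> auto G" and b: "b \<in> \<sigma> ` C" and ba: "b \<otimes> a \<in> \<sigma> ` C"
  shows False
proof -
  obtain c where c: "c \<in> C" "\<sigma> c = b" using b by auto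
  obtain f where f: "f \<in> Aut_fixing G C" "f b = c" using Aut_fixing_transitive[OF c(1)] .
  then have f_auto: "f \<in> auto G" and fC: "f ` C = C" by (auto simp: Aut_fixing_def)
  let ?g = "\<sigma> \<otimes>\<^bsub>AutoGroup G\<^esub> f"
  have g: "?g \<in> auto G"
    using \<sigma> f_auto A.m_closed by (simp add: AutoGroup_carrier)
  have g_apply: "?g z = \<sigma> (f z)" if "z \<in> carrier G" for z
    using AutoGroup_mult_apply[OF \<sigma> f_auto that] .
  \<comment> \<open>As f permutes C, the element b a is still reached from some index after
    precomposition.\<close>
  obtain x where x: "x \<in> {0, i, j, k}" "\<sigma> (f (nform True x)) = b \<otimes> a"
  proof -
    have "b \<otimes> a \<in> \<sigma> ` (f ` C)" using ba fC by simp
    then obtain z where z: "z \<in> C" "\<sigma> (f z) = b \<otimes> a" by auto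
    then obtain x where "x \<in> {0, i, j, k}" "z = nform True x" unfolding C_def by blast
    then show ?thesis using that[of x] z(2) by blast
  qed
  have ba_nform: "b \<otimes> a = nform True 1" by (simp add: nform_def)
  have gb: "?g b = b" using f c by (simp add: g_apply)
  moreover have "?g (nform True x) = nform True 1" using x(2) ba_nform by (simp add: g_apply)
  ultimately have "gcd x (int n) = gcd 1 (int n)"
    using auto_fixing_b_gcd[OF g] by blast
  then have "gcd x (int n) = 1" by simp
  \<comment> \<open>For x = 0 the gcd is n itself, which exceeds 1.\<close>
  moreover have "gcd x (int n) > 1"
    using x(1) range gcd_n by (cases "x = 0") auto
  ultimately show False by linarith
qed

end

theorem proposition4p7:
  fixes G :: "('a, 'c) monoid_scheme" (structure)
    and a b :: 'a and n :: nat and i j k l m :: int and C :: "'a set"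
  assumes "5 \<le> n" and "dihedral G n a b"
    and "C = {b, b \<otimes> a [^] i, b \<otimes> a [^] j, b \<otimes> a [^] k}"
    and "1 < i" "i < int n" "1 < j" "j < int n" "1 < k" "k < int n"
    and "coprime i j" "coprime i k" "coprime j k"
    and "\<forall>x\<in>{i, j, k}. gcd x (int n) > 1"
    and "[l\<^sup>2 = 1] (mod int n)" "[m\<^sup>2 = 1] (mod int n)"
    and "\<not> [l = 1] (mod int n)" "\<not> [m = 1] (mod int n)" "\<not> [l * m = 1] (mod int n)"
    and "[k = j * l + i] (mod int n)" "[k = i * m + j] (mod int n)"
    and "[i * (l + 1) = 0] (mod int n)" "[j * (m + 1) = 0] (mod int n)"
  shows "(card C = 4 \<and> C \<in> transitive_generating_sets G
          \<and> (even n \<longrightarrow> int n div 2 \<notin> {i, j, k}))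
    \<and> (Aut_fixing G C =
          generate (AutoGroup G)
            {dih_phi G a b [^]\<^bsub>AutoGroup G\<^esub> i \<otimes>\<^bsub>AutoGroup G\<^esub> dih_tau G a b l,
             dih_phi G a b [^]\<^bsub>AutoGroup G\<^esub> j \<otimes>\<^bsub>AutoGroup G\<^esub> dih_tau G a b m}
        \<and> Aut_fixing_group G C \<cong> integer_mod_group 2 \<times>\<times> integer_mod_group 2)
    \<and> \<not> (\<exists>\<sigma>\<in>auto G. \<exists>s::int. 2 \<le> s \<and> s \<le> int n - 1 \<and> gcd (2 * s - 1) (int n) = 1
            \<and> [2 * s * (s - 1) = 0] (mod int n)
            \<and> \<sigma> ` C = {b, b \<otimes> a, b \<otimes> a [^] s, b \<otimes> a [^] (1 - s)})
    \<and> \<not> (\<exists>\<sigma>\<in>auto G. \<exists>t::int. 1 \<le> t \<and> t \<le> int n - 2 \<and> gcd t (int n) = 1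
            \<and> [1 + t + t ^ 2 + t ^ 3 = 0] (mod int n)
            \<and> \<sigma> ` C = {b, b \<otimes> a, b \<otimes> a [^] (t + 1), b \<otimes> a [^] (t\<^sup>2 + t + 1)})"
proof -
  interpret dihedral_klein G n a b i j k l m
    using assms by (auto simp: dihedral_klein_def dihedral_klein_axioms_def)
  have C: "C = dihedral_klein.C G a b i j k"
    using assms(3) C_eq by simp
  \<comment> \<open>With u and v arbitrary, this shape covers form (1) for every s and form (2) for
    every t.\<close>
  have no: False if "\<sigma> \<in> auto G" "\<sigma> ` dihedral_klein.C G a b i j k = {b, b \<otimes> a, u, v}" for \<sigma> u v
    using b_ba_notin_image[OF that(1)] that(2) by blast
  show ?thesis
    unfolding C
  proof (intro conjI)
    show "even n \<longrightarrow> int n div 2 \<notin> {i, j, k}" using half_n_notin by (rule impI)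
  qed (fact card_C C_transitive Aut_fixing_generate[unfolded \<alpha>_def \<beta>_def] Aut_fixing_iso
      | (intro notI, elim bexE exE conjE, erule (1) no))+
qed

end
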